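(* Let $w$ be an infinite word over a finite alphabet $\Sigma$. There exists a positive integer $k$ such that $\rho_w(n) = \rho_w^k(n)$ for all $n \geq 0$ if and only if $w$ is ultimately periodic.
   Context: For words $w, x$, $|w|_x$ denotes the number of occurrences of $x$ as a factor of $w$ (number of pairs $(s,t)$ with $w = sxt$). For a positive integer $k$, words $u, v$ are $k$-abelian equivalent if $|u|_x = |v|_x$ for all words $x$ of length at most $k$. The factor complexity $\rho_w$ of an infinite word $w$ maps $n \geq 0$ to the number of distinct factors of $w$ of length $n$; the $k$-abelian complexity $\rho_w^k$ maps $n$ to the number of $k$-abelian equivalence classes of factors of $w$ of length $n$. An infinite word is ultimately periodic if it equals $u v^\omega$ for some finite words $u$ and nonempty $v$. *)

theory Defs
  imports "HOL-Library.Omega_Words_Fun"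
begin

text \<open>
  Finite words are lists. Infinite words, concatenation \<open>\<frown>\<close> and \<open>v\<^sup>\<omega>\<close> are those of
  \<^theory>\<open>HOL-Library.Omega_Words_Fun\<close>.
\<close>

definition occurrences :: "'a list \<Rightarrow> 'a list \<Rightarrow> nat" where
  "occurrences w x = card {(s, t). w = s @ x @ t}"

text \<open>
  The test words \<open>x\<close> range over the whole type: one containing a letter outside the alphabet
  of \<open>u\<close> and \<open>v\<close> occurs in neither of them, so the relation does not depend on the alphabet.
\<close>

definition k_abelian_equiv :: "nat \<Rightarrow> ('a list \<times> 'a list) set" where
  "k_abelian_equiv k =
     {(u, v). \<forall>x. length x \<le> k \<longrightarrow> occurrences u x = occurrences v x}"

lemma equiv_k_abelian_equiv: "equiv UNIV (k_abelian_equiv k)"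
  by (auto simp: k_abelian_equiv_def intro!: equivI refl_onI symI transI)

definition factors :: "'a word \<Rightarrow> nat \<Rightarrow> 'a list set" where
  "factors w n = {x. length x = n \<and> (\<exists>s t. w = s \<frown> x \<frown> t)}"

definition factor_complexity :: "'a word \<Rightarrow> nat \<Rightarrow> nat" where
  "factor_complexity w n = card (factors w n)"

definition k_abelian_complexity :: "nat \<Rightarrow> 'a word \<Rightarrow> nat \<Rightarrow> nat" where
  "k_abelian_complexity k w n = card (factors w n // k_abelian_equiv k)"

definition ultimately_periodic :: "'a word \<Rightarrow> bool" where
  "ultimately_periodic w \<longleftrightarrow> (\<exists>u v. v \<noteq> [] \<and> w = u \<frown> v\<^sup>\<omega>)"

end

theory Submission
  imports Defs
begin

text \<open>
  The two complexities agree everywhere iff \<open>k\<close>-abelian equivalent factors of the same length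
  are equal.

  If they are, choose by pigeonhole a word \<open>U\<close> that occurs infinitely often in \<open>w\<close> and in which
  some word \<open>v\<close> of length \<open>k\<close> occurs both at position \<open>0\<close> and at position \<open>s > 0\<close>. If \<open>U\<close> occurs at
  positions \<open>i\<close> and \<open>i + d\<close>, then the factors of length \<open>d + k\<close> at \<open>i\<close> and at \<open>i + s\<close> are
  \<open>k\<close>-abelian equivalent, hence equal, so \<open>w\<close> has period \<open>s\<close> between the two occurrences of \<open>U\<close>.
  Since \<open>d\<close> can be taken arbitrarily large, \<open>w\<close> is ultimately periodic.

  Conversely, an ultimately periodic word has finitely many suffixes, so for some \<open>K\<close> the factor of
  length \<open>K\<close> at a position determines the suffix starting there. Take \<open>k = K + 1\<close>. If two long
  factors of \<open>w\<close> are \<open>k\<close>-abelian equivalent, each contains the first \<open>K\<close>-letter block of the other,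
  so both start on the same cycle of suffixes; and their last \<open>K\<close>-letter blocks agree, because that
  block is the only one with an occurrence that is not followed by a letter. Going around the
  cycle from the common end shows that they start with the same suffix.
\<close>

section \<open>Factors as windows, and the two complexities compared\<close>

definition window :: "'a word \<Rightarrow> nat \<Rightarrow> nat \<Rightarrow> 'a list" where
  "window w i n = w [i \<rightarrow> i + n]"

lemma length_window [simp]: "length (window w i n) = n"
  by (simp add: window_def)

lemma nth_window [simp]: "t < n \<Longrightarrow> window w i n ! t = w (i + t)"
  by (simp add: window_def)

text \<open>Passing to classes is a map on the finite set \<open>A\<close>, and such a map preserves
  the cardinality exactly when it is injective.\<close>

lemma card_quotient_eq_iff:
  assumes "finite A" and "equiv UNIV r"
  shows "card A = card (A // r) \<longleftrightarrow> (\<forall>x\<in>A. \<forall>y\<in>A. (x, y) \<in> r \<longrightarrow> x = y)"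
proof -
  have "A // r = (\<lambda>x. r `` {x}) ` A"
    by (auto simp: quotient_def)
  moreover have "card A = card ((\<lambda>x. r `` {x}) ` A) \<longleftrightarrow> inj_on (\<lambda>x. r `` {x}) A"
    using assms(1) inj_on_iff_eq_card by metis
  ultimately show ?thesis
    using eq_equiv_class_iff[OF assms(2)] by (auto simp: inj_on_def)
qed

lemma factors_eq: "factors w n = range (\<lambda>i. window w i n)"
proof (intro set_eqI iffI)
  fix x assume "x \<in> factors w n"
  then obtain s t where *: "length x = n" "w = s \<frown> x \<frown> t"
    by (auto simp: factors_def)
  have "x = window w (length s) n"
    using * by (intro nth_equalityI) auto
  then show "x \<in> range (\<lambda>i. window w i n)" by blast
next
  fix x assume "x \<in> range (\<lambda>i. window w i n)"
  then obtain i where x: "x = window w i n" by blast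
  have "w = (w [0 \<rightarrow> i]) \<frown> window w i n \<frown> suffix (i + n) w"
    by (rule ext) (auto simp: conc_def window_def subsequence_def)
  then show "x \<in> factors w n"
    unfolding factors_def x by auto
qed

lemma finite_factors:
  assumes "finite (range w)"
  shows "finite (factors w n)"
proof (rule finite_subset)
  show "factors w n \<subseteq> {xs. set xs \<subseteq> range w \<and> length xs = n}"
    by (auto simp: factors_eq window_def subsequence_def)
  show "finite {xs. set xs \<subseteq> range w \<and> length xs = n}"
    using assms by (rule finite_lists_length_eq)
qed

lemma complexities_eq_iff:
  assumes "finite (range w)"
  shows "(\<forall>n. factor_complexity w n = k_abelian_complexity k w n) \<longleftrightarrow>
    (\<forall>n i j. (window w i n, window w j n) \<in> k_abelian_equiv k
       \<longrightarrow> window w i n = window w j n)"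
  unfolding factor_complexity_def k_abelian_complexity_def
    card_quotient_eq_iff[OF finite_factors[OF assms] equiv_k_abelian_equiv]
  by (auto simp: factors_eq)

section \<open>Counting occurrences by start position\<close>

lemma occurrences_eq_card:
  "occurrences u z = card {p. p + length z \<le> length u \<and> take (length z) (drop p u) = z}"
    (is "_ = card ?P")
proof -
  let ?g = "\<lambda>p. (take p u, drop (p + length z) u)"
  have inj: "inj_on ?g ?P"
  proof (rule inj_onI)
    fix p q assume "p \<in> ?P" "q \<in> ?P" "?g p = ?g q"
    then have "length (take p u) = length (take q u)" "p \<le> length u" "q \<le> length u" by auto
    then show "p = q" by simp
  qed
  have "?g ` ?P = {(s, t). u = s @ z @ t}"
  proof (intro set_eqI iffI)
    fix a assume "a \<in> ?g ` ?P"
    then obtain p where p: "a = ?g p" "take (length z) (drop p u) = z" by auto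
    have "u = take p u @ take (length z) (drop p u) @ drop (length z) (drop p u)"
      by (simp only: append_take_drop_id)
    then show "a \<in> {(s, t). u = s @ z @ t}"
      using p by (simp add: add.commute)
  next
    fix a assume "a \<in> {(s, t). u = s @ z @ t}"
    then obtain s t where "a = (s, t)" "u = s @ z @ t" by auto
    then have "a = ?g (length s)" "length s \<in> ?P" by auto
    then show "a \<in> ?g ` ?P" by blast
  qed
  then show ?thesis
    unfolding occurrences_def using card_image[OF inj] by simp
qed

text \<open>Start positions are taken in \<open>w\<close>, not in the factor, so counts for
  different windows are sums of one function over different intervals. If \<open>z\<close> is longer
  than \<open>n\<close>, the interval is empty.\<close>

lemma occurrences_factor:
  "occurrences (window w i n) z =
     (\<Sum>p\<in>{i..<Suc (i + n) - length z}. of_bool (window w p (length z) = z))"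
proof -
  let ?l = "length z"
  have take_drop: "take ?l (drop p (window w i n)) = window w (i + p) ?l" if "p + ?l \<le> n" for p
    using that by (intro nth_equalityI) (auto simp: add.assoc)
  have "occurrences (window w i n) z = card {p. p + ?l \<le> n \<and> window w (i + p) ?l = z}"
    unfolding occurrences_eq_card
    by (rule arg_cong[of _ _ card]) (use take_drop in auto)
  also have "\<dots> = card ((+) i ` {p. p + ?l \<le> n \<and> window w (i + p) ?l = z})"
    by (simp add: card_image)
  also have "(+) i ` {p. p + ?l \<le> n \<and> window w (i + p) ?l = z}
      = {i..<Suc (i + n) - ?l} \<inter> {p. window w p ?l = z}"
  proof (intro set_eqI iffI)
    fix p assume "p \<in> {i..<Suc (i + n) - ?l} \<inter> {p. window w p ?l = z}"
    then have "p = i + (p - i)" "(p - i) + ?l \<le> n" "window w (i + (p - i)) ?l = z"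
      by auto
    then show "p \<in> (+) i ` {p. p + ?l \<le> n \<and> window w (i + p) ?l = z}" by blast
  qed auto
  also have "card \<dots> = (\<Sum>p\<in>{i..<Suc (i + n) - ?l}. of_bool (window w p ?l = z))"
    by simp
  finally show ?thesis .
qed

section \<open>Criteria for ultimate periodicity and for equality of words\<close>

lemma window_eq_iff:
  "window w i n = window w j n \<longleftrightarrow> (\<forall>t<n. w (i + t) = w (j + t))"
  by (auto simp: list_eq_iff_nth_eq window_def subsequence_def)

text \<open>Trades the decomposition for a condition on letters, the form that both directions of
  the theorem use.\<close>

lemma ultimately_periodic_iff:
  "ultimately_periodic w \<longleftrightarrow> (\<exists>N s. s > 0 \<and> (\<forall>i\<ge>N. w (i + s) = w i))"
proof
  assume "ultimately_periodic w"
  then obtain u v where v: "v \<noteq> []" and w: "w = u \<frown> v\<^sup>\<omega>"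
    by (auto simp: ultimately_periodic_def)
  have "w (i + length v) = w i" if "i \<ge> length u" for i
  proof -
    have "(i + length v - length u) mod length v = (i - length u) mod length v"
      using that by (simp only: Nat.diff_add_assoc2 mod_add_self2)
    then show ?thesis using that v by (simp add: w conc_def iter_def)
  qed
  with v show "\<exists>N s. s > 0 \<and> (\<forall>i\<ge>N. w (i + s) = w i)" by blast
next
  assume "\<exists>N s. s > 0 \<and> (\<forall>i\<ge>N. w (i + s) = w i)"
  then obtain N s where s: "s > 0" and per: "\<And>i. i \<ge> N \<Longrightarrow> w (i + s) = w i" by blast
  have mult: "w (N + t + c * s) = w (N + t)" for t c
  proof (induction c)
    case (Suc c)
    then show ?case using per[of "N + t + c * s"] by (simp add: algebra_simps)
  qed simp
  have "w = (w [0 \<rightarrow> N]) \<frown> (window w N s)\<^sup>\<omega>"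
  proof
    fix i
    show "w i = ((w [0 \<rightarrow> N]) \<frown> (window w N s)\<^sup>\<omega>) i"
    proof (cases "i < N")
      case False
      then show ?thesis
        using s mult[of "(i - N) mod s" "(i - N) div s"]
        by (simp add: conc_def window_def subsequence_def iter_def)
    qed (simp add: conc_def window_def subsequence_def)
  qed
  moreover have "window w N s \<noteq> []" using s by (metis length_window list.size(3) less_irrefl)
  ultimately show "ultimately_periodic w" unfolding ultimately_periodic_def by blast
qed

text \<open>The word \<open>x\<close> is itself a test word and occurs once in itself, hence also in
  \<open>y\<close>, where it leaves no room for further letters.\<close>

lemma k_abelian_equiv_short_imp_eq:
  assumes "(x, y) \<in> k_abelian_equiv k" and "length x = length y" and "length x \<le> k"
  shows "x = y"
proof -
  have "occurrences x x = occurrences y x"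
    using assms by (simp add: k_abelian_equiv_def)
  moreover have "{p. p + length x \<le> length x \<and> take (length x) (drop p x) = x} = {0}" by auto
  ultimately have "occurrences y x = 1" by (simp add: occurrences_eq_card)
  then have "{(s, t). y = s @ x @ t} \<noteq> {}"
    unfolding occurrences_def by (metis card.empty zero_neq_one)
  then show ?thesis using assms(2) by auto
qed

section \<open>From equal complexities to ultimate periodicity\<close>

text \<open>Shifting the window by \<open>s\<close> loses the \<open>s\<close> start positions from
  \<open>i\<close> on and gains \<open>s\<close> new ones at the right end; the two repetitions make
  both groups contribute equally.\<close>

lemma k_abelian_equiv_shift:
  assumes rep: "\<And>q. q < s + k \<Longrightarrow> w (i + d + q) = w (i + q)"
    and per: "\<And>q. q < k \<Longrightarrow> w (i + s + q) = w (i + q)"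
    and s: "s > 0"
  shows "(window w i (d + k), window w (i + s) (d + k)) \<in> k_abelian_equiv k"
proof -
  have "occurrences (window w i (d + k)) z = occurrences (window w (i + s) (d + k)) z"
    if z: "length z \<le> k" for z
  proof -
    define f :: "nat \<Rightarrow> nat" where "f p = of_bool (window w p (length z) = z)" for p
    \<comment> \<open>The number of start positions of \<open>z\<close> inside a block of length
      \<open>k\<close>.\<close>
    define e where "e = Suc k - length z"
    have shift: "sum f {a + c..<b + c} = sum f {a..<b}"
      if "\<And>p q. a \<le> p \<Longrightarrow> p < b \<Longrightarrow> q < length z \<Longrightarrow> w (p + c + q) = w (p + q)" for a b c
      using that unfolding sum.shift_bounds_nat_ivl f_def
      by (intro sum.cong refl arg_cong[of _ _ of_bool] arg_cong[of _ _ "\<lambda>x. x = z"])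
         (simp add: window_eq_iff)
    have 1: "sum f {i + e + d..<i + e + s + d} = sum f {i + e..<i + e + s}"
    proof (rule shift)
      fix p q assume "i + e \<le> p" "p < i + e + s" "q < length z"
      then show "w (p + d + q) = w (p + q)"
        using rep[of "p - i + q"] z by (simp add: e_def algebra_simps)
    qed
    have 2: "sum f {i + s..<i + e + s} = sum f {i..<i + e}"
    proof (rule shift)
      fix p q assume "i \<le> p" "p < i + e" "q < length z"
      then show "w (p + s + q) = w (p + q)"
        using per[of "p - i + q"] z by (simp add: e_def algebra_simps)
    qed
    have split: "sum f {a..<b} + sum f {b..<c} = sum f {a..<c}" if "a \<le> b" "b \<le> c" for a b c
      using that by (rule sum.atLeastLessThan_concat)
    \<comment> \<open>By 2, the lost positions \<open>{i..<i + s}\<close> contribute as much as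
      \<open>{i + e..<i + e + s}\<close>; by 1, this is what the gained ones contribute.\<close>
    have "sum f {i..<i + e + d} = sum f {i + s..<i + e + s + d}"
      using 1 2 split[of i "i + e" "i + e + s"] split[of i "i + s" "i + e + s"]
        split[of i "i + e + d" "i + e + s + d"] split[of i "i + s" "i + e + s + d"]
      by simp
    moreover have "Suc (i + (d + k)) - length z = i + e + d"
      "Suc (i + s + (d + k)) - length z = i + e + s + d"
      using z by (simp_all add: e_def)
    ultimately show ?thesis
      by (simp add: occurrences_factor f_def)
  qed
  then show ?thesis by (simp add: k_abelian_equiv_def)
qed

lemma infinitely_recurring_factor:
  assumes "finite (range w)"
  shows "\<exists>t0. \<exists>\<^sub>\<infinity>t. window w t n = window w t0 n"
proof -
  have "finite (range (\<lambda>t. window w t n))"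
    using finite_factors[OF assms] by (simp add: factors_eq)
  from pigeonhole_infinite[OF infinite_UNIV_nat this] show ?thesis
    by (auto simp: INFM_iff_infinite)
qed

text \<open>The bound on \<open>b\<close> does not depend on \<open>t\<close>, so the length of a
  word containing both copies can be fixed before its position is chosen.\<close>

lemma repeated_factor:
  assumes "finite (range w)"
  obtains a b where "a < b" "b \<le> card (factors w n)"
    "window w (t + a) n = window w (t + b) n"
proof -
  let ?F = "\<lambda>a. window w (t + a) n"
  have "card (?F ` {..card (factors w n)}) \<le> card (factors w n)"
    using finite_factors[OF assms] by (intro card_mono) (auto simp: factors_eq)
  then have "\<not> inj_on ?F {..card (factors w n)}"
    by (intro pigeonhole) simp
  then obtain a b where "a \<noteq> b" "a \<le> card (factors w n)" "b \<le> card (factors w n)" "?F a = ?F b"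
    by (auto simp: inj_on_def)
  then show thesis
    using that[of a b] that[of b a] by (cases "a < b") auto
qed

lemma ultimately_periodic_if_k_abelian_equiv_imp_eq:
  assumes fin: "finite (range w)"
    and inj: "\<And>n i j. (window w i n, window w j n) \<in> k_abelian_equiv k
      \<Longrightarrow> window w i n = window w j n"
  shows "ultimately_periodic w"
proof -
  define M where "M = card (factors w k)"
  obtain t0 where t0: "\<exists>\<^sub>\<infinity>t. window w t (M + k) = window w t0 (M + k)"
    using infinitely_recurring_factor[OF fin] by blast
  obtain a b where ab: "a < b" "b \<le> M" "window w (t0 + a) k = window w (t0 + b) k"
    using repeated_factor[OF fin] unfolding M_def by blast
  define i s where "i = t0 + a" and "s = b - a"
  have s: "s > 0" using ab by (simp add: s_def)
  have per: "w (i + s + q) = w (i + q)" if "q < k" for q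
    using that ab by (simp add: window_eq_iff i_def s_def)
  have "w (i + r + s) = w (i + r)" for r
  proof -
    \<comment> \<open>A copy this far to the right makes the compared windows long enough to reach
      offset \<open>r\<close>.\<close>
    obtain t where t: "t > t0 + r" "window w t (M + k) = window w t0 (M + k)"
      using t0 unfolding INFM_nat by blast
    define d where "d = t - t0"
    have "w (i + d + q) = w (i + q)" if "q < s + k" for q
    proof -
      \<comment> \<open>As \<open>a + s = b \<le> M\<close>, the position lies inside the recurring
        word.\<close>
      have "a + q < M + k" using that ab by (simp add: s_def)
      then have "w (t + (a + q)) = w (t0 + (a + q))" using t(2) by (simp add: window_eq_iff)
      then show ?thesis using t(1) by (simp add: i_def d_def algebra_simps)
    qed
    from inj[OF k_abelian_equiv_shift[OF this per s]]
    have "\<forall>q<d + k. w (i + q) = w (i + s + q)" by (simp add: window_eq_iff)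
    moreover have "r < d + k" using t(1) by (simp add: d_def)
    ultimately have "w (i + r) = w (i + s + r)" by blast
    then show ?thesis by (simp add: add_ac)
  qed
  then have "\<forall>j\<ge>i. w (j + s) = w j" by (metis le_Suc_ex)
  then show ?thesis using s ultimately_periodic_iff by blast
qed

section \<open>From ultimate periodicity to equal complexities\<close>

lemma finite_set_of_words_separated:
  fixes S :: "'a word set"
  assumes "finite S"
  shows "\<exists>K. \<forall>f\<in>S. \<forall>g\<in>S. (\<forall>t<K. f t = g t) \<longrightarrow> f = g"
proof -
  \<comment> \<open>The first position of disagreement. For equal words the value is arbitrary,
    which is harmless: \<open>K\<close> only has to exceed finitely many numbers.\<close>
  define d :: "'a word \<times> 'a word \<Rightarrow> nat" where "d = (\<lambda>(f, g). LEAST t. f t \<noteq> g t)"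
  have "finite (d ` (S \<times> S))" using assms by simp
  then obtain K where K: "\<forall>t\<in>d ` (S \<times> S). t < K"
    using finite_nat_set_iff_bounded by blast
  have "f = g" if "f \<in> S" "g \<in> S" and eq: "\<forall>t<K. f t = g t" for f g
  proof (rule ccontr)
    assume "f \<noteq> g"
    then have "\<exists>t. f t \<noteq> g t" by auto
    then have "f (d (f, g)) \<noteq> g (d (f, g))" unfolding d_def prod.case by (rule LeastI_ex)
    moreover have "d (f, g) < K" using K that by blast
    ultimately show False using eq by blast
  qed
  then show ?thesis by blast
qed

lemma finite_suffixes_if_ultimately_periodic:
  assumes "ultimately_periodic w"
  shows "finite (range (\<lambda>i. suffix i w))"
proof -
  obtain N s where s: "s > 0" and per: "\<And>i. i \<ge> N \<Longrightarrow> w (i + s) = w i"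
    using assms ultimately_periodic_iff by blast
  have "suffix i w \<in> (\<lambda>i. suffix i w) ` {..<N + s}" for i
  proof (induction i rule: less_induct)
    case (less i)
    show ?case
    proof (cases "i < N + s")
      case False
      have "suffix i w = suffix (i - s) w"
      proof
        fix t show "suffix i w t = suffix (i - s) w t"
          using per[of "i - s + t"] False by (simp add: algebra_simps)
      qed
      moreover have "i - s < i" using False s by simp
      ultimately show ?thesis using less by metis
    qed simp
  qed
  then have "range (\<lambda>i. suffix i w) \<subseteq> (\<lambda>i. suffix i w) ` {..<N + s}" by blast
  then show ?thesis by (rule finite_subset) simp
qed

lemma suffix_eq_add:
  "suffix i w = suffix j w \<Longrightarrow> suffix (i + c) w = suffix (j + c) w"
  by (metis suffix_suffix)

text \<open>Advancing by \<open>a + b\<close> leads from either suffix back to itself, so neither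
  can differ from the other and merge with it later.\<close>

lemma suffix_eq_if_mutually_reachable:
  assumes a: "suffix i w = suffix (j + a) w" and b: "suffix j w = suffix (i + b) w"
    and m: "suffix (i + m) w = suffix (j + m) w"
  shows "suffix i w = suffix j w"
proof (cases "a + b = 0")
  case False
  have loop: "suffix l w = suffix (l + r * (a + b)) w"
    if "suffix l w = suffix (l + (a + b)) w" for l r
  proof (induction r)
    case (Suc r)
    have "l + (a + b) + r * (a + b) = l + Suc r * (a + b)" by simp
    then show ?case
      using Suc suffix_eq_add[OF that, of "r * (a + b)"] by metis
  qed simp
  have "suffix i w = suffix (i + (a + b)) w"
    using a suffix_eq_add[OF b, of a] by (simp add: algebra_simps)
  note i = loop[OF this, of m]
  have "suffix j w = suffix (j + (a + b)) w"
    using b suffix_eq_add[OF a, of b] by (simp add: algebra_simps)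
  note j = loop[OF this, of m]
  \<comment> \<open>A multiple of \<open>a + b\<close> that is at least \<open>m\<close>: after so
    many letters both suffixes are back at their start and have already merged.\<close>
  have "m \<le> m * (a + b)" using False by (cases "a + b") simp_all
  then obtain c where "m * (a + b) = m + c" using le_Suc_ex by blast
  then have "suffix (i + m * (a + b)) w = suffix (j + m * (a + b)) w"
    using suffix_eq_add[OF m, of c] by (simp add: algebra_simps)
  then show ?thesis using i j by simp
qed (use a in simp)

lemma k_abelian_equiv_imp_eq_if_suffixes_separated:
  assumes sep: "\<And>i j. window w i K = window w j K \<Longrightarrow> suffix i w = suffix j w"
    and eqv: "(window w i n, window w j n) \<in> k_abelian_equiv (Suc K)"
  shows "window w i n = window w j n"
proof (cases "n \<le> K")
  case True
  then show ?thesis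
    by (intro k_abelian_equiv_short_imp_eq[OF eqv]) auto
next
  case False
  define m where "m = n - K"
  have n: "n = m + K" using False by (simp add: m_def)
  have occ: "occurrences (window w i n) z = occurrences (window w j n) z"
    if "length z \<le> Suc K" for z
    using eqv that by (simp add: k_abelian_equiv_def)
  have reach: "\<exists>a. suffix p w = suffix (q + a) w"
    if "occurrences (window w p n) (window w p K) = occurrences (window w q n) (window w p K)"
    for p q
  proof -
    have len: "length (window w p K) = K" by (simp add: window_def subsequence_def)
    have "occurrences (window w p n) (window w p K) > 0"
      unfolding occurrences_factor len using n by (intro sum_pos2[of _ p]) auto
    then have "(\<Sum>r\<in>{q..<Suc (q + n) - K}. of_bool (window w r K = window w p K)) \<noteq> (0::nat)"
      using that unfolding occurrences_factor len by linarith
    then obtain r where "q \<le> r" "window w r K = window w p K"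
      by (auto elim!: sum.not_neutral_contains_not_neutral)
    then show ?thesis using sep by (metis le_Suc_ex)
  qed
  obtain a where a: "suffix i w = suffix (j + a) w"
    using reach[of i j] occ by auto
  obtain b where b: "suffix j w = suffix (i + b) w"
    using reach[of j i] occ by auto
  have "suffix (i + m) w = suffix (j + m) w"
  proof -
    define z where "z = window w (i + m) K"
    define z' where "z' = window w (i + m) (Suc K)"
    have len: "length z = K" "length z' = Suc K" by (simp_all add: z_def z'_def)
    \<comment> \<open>A block of length \<open>K\<close> determines the suffix and thus its next
      letter, so \<open>z\<close> and its extension \<open>z'\<close> start at the same positions of
      \<open>w\<close>.\<close>
    have ext: "window w p (Suc K) = z' \<longleftrightarrow> window w p K = z" for p
    proof
      assume "window w p K = z"
      then have "suffix p w = suffix (i + m) w" unfolding z_def by (rule sep)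
      then have "w (p + t) = w (i + m + t)" for t by (metis suffix_nth)
      then show "window w p (Suc K) = z'" unfolding z'_def window_eq_iff by blast
    qed (simp add: z_def z'_def window_eq_iff del: add_Suc_right)
    \<comment> \<open>Only at \<open>q + m\<close> does a block of length \<open>K\<close> fit into
      the window while one of length \<open>Suc K\<close> does not.\<close>
    have last: "occurrences (window w q n) z
        = occurrences (window w q n) z' + of_bool (window w (q + m) K = z)" for q
    proof -
      have "Suc (q + n) - K = Suc (q + m)" "Suc (q + n) - Suc K = q + m" using n by simp_all
      then show ?thesis unfolding occurrences_factor len ext by simp
    qed
    \<comment> \<open>The extra term is 1 for \<open>i\<close> by the choice of \<open>z\<close>,
      and all other counts agree, so it is 1 for \<open>j\<close>.\<close>
    have "window w (j + m) K = z"
      using last[of i] last[of j] occ[of z] occ[of z'] len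
      by (cases "window w (j + m) K = z") (simp_all add: z_def)
    then show ?thesis using sep z_def by metis
  qed
  from suffix_eq_if_mutually_reachable[OF a b this]
  have "w (i + t) = w (j + t)" for t by (metis suffix_nth)
  then show ?thesis by (simp add: window_eq_iff)
qed

theorem theorem2:
  fixes \<Sigma> :: "'a set" and w :: "'a word"
  assumes "finite \<Sigma>" and "range w \<subseteq> \<Sigma>"
  shows "(\<exists>k>0. \<forall>n. factor_complexity w n = k_abelian_complexity k w n)
           \<longleftrightarrow> ultimately_periodic w"
proof -
  have fin: "finite (range w)" using assms finite_subset by blast
  show ?thesis
    unfolding complexities_eq_iff[OF fin]
  proof
    assume "\<exists>k>0. \<forall>n i j. (window w i n, window w j n) \<in> k_abelian_equiv k
      \<longrightarrow> window w i n = window w j n"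
    then show "ultimately_periodic w"
      using ultimately_periodic_if_k_abelian_equiv_imp_eq[OF fin] by blast
  next
    assume "ultimately_periodic w"
    from finite_set_of_words_separated[OF finite_suffixes_if_ultimately_periodic[OF this]]
    obtain K where K: "\<And>i j. (\<forall>t<K. w (i + t) = w (j + t)) \<Longrightarrow> suffix i w = suffix j w"
      by auto
    have "suffix i w = suffix j w" if "window w i K = window w j K" for i j
      using that by (intro K) (simp add: window_eq_iff)
    note k_abelian_equiv_imp_eq_if_suffixes_separated[OF this]
    then show "\<exists>k>0. \<forall>n i j. (window w i n, window w j n) \<in> k_abelian_equiv k
      \<longrightarrow> window w i n = window w j n"
      by (intro exI[of _ "Suc K"]) blast
  qed
qed

end
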